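(* For every choice of $q=q(n)\ge0$, $$L(n,q)\lesssim \frac{192\,n\,2^n}{\log_2 n},$$ i.e. $L(n,q(n))\le (1+o(1))\,\dfrac{192\,n\,2^n}{\log_2 n}$ as $n\to\infty$.
   Context: For $m\ge1$, a $k$-CNOT gate on $m$ lines with control lines $i_1,\dots,i_k$ and target line $j\notin\{i_1,\dots,i_k\}$ is the map $\mathbb Z_2^m\to\mathbb Z_2^m$ replacing $x_j$ by $x_j\oplus(x_{i_1}\wedge\dots\wedge x_{i_k})$ and leaving other coordinates unchanged; NOT, CNOT, 2-CNOT are the cases $k=0,1,2$. A reversible circuit on $m$ lines is a finite sequence of such gates, computing their composition $g$; its complexity is its number of gates. With $\phi_{n,n+q}(\langle x_1,\dots,x_n\rangle)=\langle x_1,\dots,x_n,0,\dots,0\rangle\in\mathbb Z_2^{n+q}$ and $\psi_{n+q,n}(\langle x_1,\dots,x_{n+q}\rangle)=\langle x_1,\dots,x_n\rangle$, a circuit on $n+q$ lines implements $f\colon\mathbb Z_2^n\to\mathbb Z_2^n$ with $q$ additional inputs if $\psi_{n+q,n}(g(\phi_{n,n+q}(\vec x)))=f(\vec x)$ for all $\vec x$. $F(n,q)$ is the set of maps $\mathbb Z_2^n\to\mathbb Z_2^n$ implementable this way. The Shannon function $L(n,q)$ is the maximum, over all $f\in F(n,q)$, of the minimum complexity of a reversible circuit of NOT, CNOT, 2-CNOT gates implementing $f$ with $q$ additional inputs. *)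

theory Defs
  imports Complex_Main
begin

text \<open>Lines are indexed 0..m-1; a state of m lines is a bool list of length m
 (True = 1). A gate is given by its list of control lines and its target line.\<close>

datatype gate = Gate "nat list" nat

fun valid_gate :: "nat \<Rightarrow> gate \<Rightarrow> bool" where
  "valid_gate m (Gate cs j) \<longleftrightarrow>
     length cs \<le> 2 \<and> distinct cs \<and> j < m \<and> (\<forall>i\<in>set cs. i < m) \<and> j \<notin> set cs"

fun apply_gate :: "gate \<Rightarrow> bool list \<Rightarrow> bool list" where
  "apply_gate (Gate cs j) xs = xs[j := (xs ! j \<noteq> (\<forall>i\<in>set cs. xs ! i))]"

definition run_circuit :: "gate list \<Rightarrow> bool list \<Rightarrow> bool list" where
  "run_circuit C xs = fold apply_gate C xs"

definition valid_circuit :: "nat \<Rightarrow> gate list \<Rightarrow> bool" where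
  "valid_circuit m C \<longleftrightarrow> (\<forall>g\<in>set C. valid_gate m g)"

definition phi :: "nat \<Rightarrow> bool list \<Rightarrow> bool list" where
  "phi q xs = xs @ replicate q False"

definition psi :: "nat \<Rightarrow> bool list \<Rightarrow> bool list" where
  "psi n xs = take n xs"

definition implements :: "nat \<Rightarrow> nat \<Rightarrow> gate list \<Rightarrow> (bool list \<Rightarrow> bool list) \<Rightarrow> bool" where
  "implements n q C f \<longleftrightarrow> valid_circuit (n + q) C \<and>
     (\<forall>xs. length xs = n \<longrightarrow> psi n (run_circuit C (phi q xs)) = f xs)"

definition F :: "nat \<Rightarrow> nat \<Rightarrow> (bool list \<Rightarrow> bool list) set" where
  "F n q = {f. \<exists>C. implements n q C f}"

definition complexity :: "nat \<Rightarrow> nat \<Rightarrow> (bool list \<Rightarrow> bool list) \<Rightarrow> nat" where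
  "complexity n q f = (LEAST k. \<exists>C. length C = k \<and> implements n q C f)"

definition L :: "nat \<Rightarrow> nat \<Rightarrow> nat" where
  "L n q = Max {complexity n q f | f. f \<in> F n q}"

end

theory Submission
  imports Defs "HOL-Combinatorics.Permutations" "HOL-Real_Asymp.Real_Asymp"
begin

text \<open>A state of the lines is identified with the set of lines carrying 1. To realise a bijection
  \<open>g\<close> on the inputs, one repeatedly picks \<open>K\<close> wrong inputs \<open>x\<close> such that the
  pairs \<open>{x, g x}\<close> are disjoint, and composes with the product of these \<open>K\<close> transpositions.
  Written as rows of a matrix, the \<open>2 K\<close> states involved have at most \<open>4 ^ K\<close> distinct
  columns, so for \<open>K\<close> of order \<open>log n\<close> almost all lines are cleared on them by one CNOT each.
  If \<open>K\<close> is a power of two, the states can then be moved into a subcube on which one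
  multiply controlled NOT performs all transpositions simultaneously. A batch therefore costs about
  \<open>12 m\<close> gates on \<open>m \<le> 2 n\<close> lines, and there are at most \<open>2 ^ n / K\<close> batches with
  \<open>6 K > log n\<close>. The few remaining inputs are treated by 3-cycles; a final transposition
  is excluded because circuits on at least four lines are even permutations.\<close>

section \<open>Circuits acting on sets of lines\<close>

text \<open>No number of lines enters this encoding, so appended zero lines are invisible and a
  circuit acts in the same way when further lines are added.\<close>

fun gate_act :: "gate \<Rightarrow> nat set \<Rightarrow> nat set" where
  "gate_act (Gate cs j) s = {i. (i \<in> s) \<noteq> (i = j \<and> set cs \<subseteq> s)}"

definition run :: "gate list \<Rightarrow> nat set \<Rightarrow> nat set" where
  "run C s = fold gate_act C s"

lemma run_Nil [simp]: "run [] s = s"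
  and run_Cons [simp]: "run (g # C) s = run C (gate_act g s)"
  and run_append [simp]: "run (C @ C') s = run C' (run C s)"
  by (simp_all add: run_def)

lemma valid_circuit_Nil [simp]: "valid_circuit m []"
  and valid_circuit_Cons [simp]: "valid_circuit m (g # C) \<longleftrightarrow> valid_gate m g \<and> valid_circuit m C"
  and valid_circuit_append [simp]:
    "valid_circuit m (C @ C') \<longleftrightarrow> valid_circuit m C \<and> valid_circuit m C'"
  and valid_circuit_rev [simp]: "valid_circuit m (rev C) \<longleftrightarrow> valid_circuit m C"
  by (auto simp: valid_circuit_def)

lemma gate_act_involution: "valid_gate m g \<Longrightarrow> gate_act g (gate_act g s) = s"
  by (cases g) auto

lemma gate_act_Pow: "valid_gate m g \<Longrightarrow> s \<subseteq> {..<m} \<Longrightarrow> gate_act g s \<subseteq> {..<m}"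
  by (cases g) auto

lemma run_rev: "valid_circuit m C \<Longrightarrow> run (rev C) (run C s) = s"
  by (induction C arbitrary: s) (auto simp: gate_act_involution)

lemma run_rev': "valid_circuit m C \<Longrightarrow> run C (run (rev C) s) = s"
  using run_rev[of m "rev C" s] by simp

lemma run_inject: "valid_circuit m C \<Longrightarrow> run C s = run C s' \<longleftrightarrow> s = s'"
  by (metis run_rev)

lemma run_Pow: "valid_circuit m C \<Longrightarrow> s \<subseteq> {..<m} \<Longrightarrow> run C s \<subseteq> {..<m}"
  by (induction C arbitrary: s) (auto simp: gate_act_Pow)

lemma bij_betw_run:
  assumes "valid_circuit m C"
  shows "bij_betw (run C) (Pow {..<m}) (Pow {..<m})"
  using run_Pow[of m C] run_Pow[of m "rev C"] run_rev[OF assms] run_rev'[OF assms] assms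
  by (intro bij_betw_byWitness[where f' = "run (rev C)"]) auto

lemma valid_circuit_mono:
  assumes "valid_circuit m C" "m \<le> m'"
  shows "valid_circuit m' C"
proof -
  have "valid_gate m' g" if "valid_gate m g" for g
    using that assms(2) by (cases g) auto
  then show ?thesis
    using assms(1) by (auto simp: valid_circuit_def)
qed

section \<open>Elementary layers\<close>

lemma run_nots:
  assumes "distinct js"
  shows "run (map (Gate []) js) s = {i. (i \<in> s) \<noteq> (i \<in> set js)}"
  using assms by (induction js arbitrary: s) auto

lemma nots_circuit:
  assumes "V \<subseteq> {..<m}"
  obtains C where "valid_circuit m C" "length C = card V" "\<And>s. run C s = {i. (i \<in> s) \<noteq> (i \<in> V)}"
proof -
  have "finite V" using assms finite_subset by blast
  then obtain js where js: "set js = V" "distinct js" using finite_distinct_list by blast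
  show thesis
  proof (rule that[of "map (Gate []) js"])
    show "valid_circuit m (map (Gate []) js)"
      using js assms by (auto simp: valid_circuit_def)
    show "length (map (Gate []) js) = card V"
      using js distinct_card by force
    show "run (map (Gate []) js) s = {i. (i \<in> s) \<noteq> (i \<in> V)}" for s
      using run_nots[OF js(2)] js(1) by simp
  qed
qed

text \<open>No line is both a source and a target, so no gate of the layer influences another and
  their order is immaterial.\<close>

lemma run_cnots:
  assumes "distinct js" "\<rho> ` set js \<inter> set js = {}"
  shows "run (map (\<lambda>j. Gate [\<rho> j] j) js) s = {i. (i \<in> s) \<noteq> (i \<in> set js \<and> \<rho> i \<in> s)}"
  using assms
proof (induction js arbitrary: s)
  case (Cons j js)
  then show ?case by (auto 4 3)
qed simp

lemma cnots_circuit: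
  assumes "J \<subseteq> {..<m}" "\<rho> ` J \<subseteq> {..<m}" "\<rho> ` J \<inter> J = {}"
  obtains C where "valid_circuit m C" "length C = card J"
    "\<And>s. run C s = {i. (i \<in> s) \<noteq> (i \<in> J \<and> \<rho> i \<in> s)}"
proof -
  have "finite J" using assms finite_subset by blast
  then obtain js where js: "set js = J" "distinct js" using finite_distinct_list by blast
  show thesis
  proof (rule that[of "map (\<lambda>j. Gate [\<rho> j] j) js"])
    show "valid_circuit m (map (\<lambda>j. Gate [\<rho> j] j) js)"
      using js assms by (auto simp: valid_circuit_def)
    show "length (map (\<lambda>j. Gate [\<rho> j] j) js) = card J"
      using js distinct_card by force
    show "run (map (\<lambda>j. Gate [\<rho> j] j) js) s = {i. (i \<in> s) \<noteq> (i \<in> J \<and> \<rho> i \<in> s)}" for s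
      using run_cnots[OF js(2), of \<rho>] js(1) assms(3) by simp
  qed
qed

section \<open>Gates with many controls\<close>

text \<open>The k-CNOT with control set \<open>S\<close>; with more than two controls it is not an
  admissible gate and has to be synthesised.\<close>

definition mcx :: "nat set \<Rightarrow> nat \<Rightarrow> nat set \<Rightarrow> nat set" where
  "mcx S t s = {i. (i \<in> s) \<noteq> (i = t \<and> S \<subseteq> s)}"

text \<open>Each pair holds a control and a borrowed line of unknown content; \<open>c\<close> is
  the innermost control. The list is a palindrome, hence its own inverse when valid.\<close>

fun ladder :: "nat \<Rightarrow> (nat \<times> nat) list \<Rightarrow> nat \<Rightarrow> gate list" where
  "ladder c [] t = [Gate [c] t]"
| "ladder c ((b, a) # ps) t = Gate [b, a] t # ladder c ps a @ [Gate [b, a] t]"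

lemma length_ladder: "length (ladder c ps t) = 2 * length ps + 1"
  by (induction c ps t rule: ladder.induct) auto

lemma rev_ladder: "rev (ladder c ps t) = ladder c ps t"
  by (induction c ps t rule: ladder.induct) auto

lemma valid_ladder:
  assumes "distinct (c # t # map fst ps @ map snd ps)"
    "set (c # t # map fst ps @ map snd ps) \<subseteq> {..<m}"
  shows "valid_circuit m (ladder c ps t)"
  using assms by (induction c ps t rule: ladder.induct) auto

lemma run_ladder_unchanged:
  assumes "i \<notin> set (t # map snd ps)"
  shows "i \<in> run (ladder c ps t) s \<longleftrightarrow> i \<in> s"
  using assms by (induction c ps t arbitrary: s rule: ladder.induct) auto

definition flip :: "nat \<Rightarrow> bool \<Rightarrow> nat set \<Rightarrow> nat set" where
  "flip t p s = {i. (i \<in> s) \<noteq> (i = t \<and> p)}"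

text \<open>The line \<open>u\<close> is neither read nor written. This lets toggles of the target
  be moved past an inner ladder when two ladders are composed.\<close>

lemma run_ladder_flip:
  assumes "u \<notin> set (c # t # map fst ps @ map snd ps)"
  shows "run (ladder c ps t) (flip u p s) = flip u p (run (ladder c ps t) s)"
  using assms
proof (induction c ps t arbitrary: s rule: ladder.induct)
  case (2 c x a ps t)
  have G: "gate_act (Gate [x, a] t) (flip u p s) = flip u p (gate_act (Gate [x, a] t) s)" for s
    using 2(2) by (auto simp: flip_def)
  show ?case
    using 2 by (simp add: G del: gate_act.simps)
qed (auto simp: flip_def)

text \<open>Both before and after the inner ladder, \<open>t\<close> receives the conjunction of
  \<open>x\<close> and \<open>a\<close>. The unknown old value of \<open>a\<close> cancels between
  the two, leaving the conjunction of \<open>x\<close> with the change of \<open>a\<close>.\<close>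

lemma run_ladder_target:
  assumes "distinct (c # t # map fst ps @ map snd ps)"
  shows "t \<in> run (ladder c ps t) s \<longleftrightarrow> (t \<in> s) \<noteq> (insert c (fst ` set ps) \<subseteq> s)"
  using assms
proof (induction c ps t arbitrary: s rule: ladder.induct)
  case (2 c x a ps t)
  define s1 where "s1 = gate_act (Gate [x, a] t) s"
  define s2 where "s2 = run (ladder c ps a) s1"
  have "t \<in> s2 \<longleftrightarrow> t \<in> s1" "x \<in> s2 \<longleftrightarrow> x \<in> s1"
    unfolding s2_def using 2(2) by (auto intro!: run_ladder_unchanged)
  moreover have "a \<in> s2 \<longleftrightarrow> (a \<in> s1) \<noteq> (insert c (fst ` set ps) \<subseteq> s1)"
    unfolding s2_def using 2 by auto
  moreover have "i \<in> s1 \<longleftrightarrow> i \<in> s" if "i \<noteq> t" for i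
    using that by (auto simp: s1_def)
  moreover have "t \<in> s1 \<longleftrightarrow> (t \<in> s) \<noteq> (x \<in> s \<and> a \<in> s)" by (auto simp: s1_def)
  moreover have "insert c (fst ` set ps) \<subseteq> s1 \<longleftrightarrow> insert c (fst ` set ps) \<subseteq> s"
    using 2(2) by (auto simp: s1_def)
  moreover have "t \<in> run (ladder c ((x, a) # ps) t) s \<longleftrightarrow> (t \<in> s2) \<noteq> (x \<in> s2 \<and> a \<in> s2)"
    by (simp add: s2_def s1_def)
  moreover have "x \<noteq> t" "a \<noteq> t" using 2(2) by auto
  ultimately show ?case by auto
qed auto

text \<open>A ladder also flips the borrowed lines; repeating it without its outermost rung undoes this.\<close>

lemma run_ladder_twice:
  assumes "distinct (c # t # b # a # map fst ps @ map snd ps)"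
  shows "run (ladder c ((b, a) # ps) t @ ladder c ps a) s = mcx (insert c (insert b (fst ` set ps))) t s"
proof -
  define D where "D = ladder c ps a"
  have inv: "run D (run D s) = s" for s
  proof -
    define m where "m = Suc (Max (set (c # a # map fst ps @ map snd ps)))"
    have "set (c # a # map fst ps @ map snd ps) \<subseteq> {..<m}"
      unfolding m_def by (meson List.finite_set Max_ge lessThan_iff less_Suc_eq_le subsetI)
    then have "valid_circuit m D"
      unfolding D_def using assms by (intro valid_ladder) auto
    then show ?thesis using run_rev[of m D s] by (simp add: D_def rev_ladder)
  qed
  define T where "T = flip t"
  have frame: "run D (T p s) = T p (run D s)" for s p
    unfolding D_def T_def using assms by (intro run_ladder_flip) auto
  have G: "gate_act (Gate [b, a] t) s = T (b \<in> s \<and> a \<in> s) s" for s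
    by (auto simp: T_def flip_def)
  have bD: "b \<in> run D s \<longleftrightarrow> b \<in> s" for s
    unfolding D_def using assms by (intro run_ladder_unchanged) auto
  have aD: "a \<in> run D s \<longleftrightarrow> (a \<in> s) \<noteq> (insert c (fst ` set ps) \<subseteq> s)" for s
    unfolding D_def using assms by (intro run_ladder_target) auto
  have T: "b \<in> T p s \<longleftrightarrow> b \<in> s" "a \<in> T p s \<longleftrightarrow> a \<in> s" "T q (T p s) = T (p \<noteq> q) s" for p q s
    using assms by (auto simp: T_def flip_def)
  have "run (ladder c ((b, a) # ps) t @ ladder c ps a) s
      = T ((b \<in> s \<and> a \<in> s) \<noteq> (b \<in> s \<and> ((a \<in> s) \<noteq> (insert c (fst ` set ps) \<subseteq> s)))) s"
    by (simp only: ladder.simps D_def[symmetric] run_append run_Cons run_Nil append_Cons G frame T inv bD aD)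
  also have "\<dots> = mcx (insert c (insert b (fst ` set ps))) t s"
    by (auto simp: T_def flip_def mcx_def)
  finally show ?thesis .
qed

text \<open>All controls but one need a borrowed line each, because the ladder ends in a single
  CNOT; hence the \<open>+ 1\<close> in the hypothesis. The \<open>+ 1\<close> in the length covers
  an empty \<open>S\<close>.\<close>

lemma mcx_circuit_many_borrowed:
  assumes "S \<subseteq> {..<m}" "t < m" "t \<notin> S" "A \<subseteq> {..<m}" "A \<inter> insert t S = {}" "card S \<le> card A + 1"
  obtains C where "valid_circuit m C" "length C \<le> 4 * card S + 1" "\<And>s. run C s = mcx S t s"
proof -
  have "finite S" "finite A" using assms finite_subset by blast+
  then obtain cs where cs: "set cs = S" "distinct cs" using finite_distinct_list by blast
  obtain as where as: "set as = A" "distinct as" using \<open>finite A\<close> finite_distinct_list by blast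
  have len: "length cs = card S" "length as = card A" using cs as distinct_card by force+
  consider "cs = []" | c where "cs = [c]" | c b bs where "cs = c # b # bs"
    by (metis neq_Nil_conv)
  then show thesis
  proof cases
    case 1
    show thesis
      by (rule that[of "[Gate [] t]"]) (use 1 cs assms in \<open>auto simp: mcx_def\<close>)
  next
    case 2
    show thesis
      by (rule that[of "[Gate [c] t]"]) (use 2 cs assms in \<open>auto simp: mcx_def\<close>)
  next
    case 3
    then obtain a as' where a: "as = a # as'"
      using len assms(6) by (cases as) auto
    define ps where "ps = zip bs as'"
    have l: "length bs \<le> length as'" using len assms(6) 3 a by simp
    have fst: "map fst ps = bs" unfolding ps_def using l by (simp add: map_fst_zip_take)
    have snd: "map snd ps = take (length bs) as'" unfolding ps_def using l by (simp add: map_snd_zip_take min_def)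
    have tk: "set (take (length bs) as') \<subseteq> set as'" by (rule set_take_subset)
    have dist: "distinct (c # t # b # a # map fst ps @ map snd ps)"
      unfolding fst snd using cs as 3 a assms tk by fastforce
    have sub: "set (c # t # b # a # map fst ps @ map snd ps) \<subseteq> {..<m}"
      unfolding fst snd using cs as 3 a assms tk by fastforce
    show thesis
    proof (rule that[of "ladder c ((b, a) # ps) t @ ladder c ps a"])
      show "valid_circuit m (ladder c ((b, a) # ps) t @ ladder c ps a)"
        using dist sub unfolding valid_circuit_append by (intro conjI valid_ladder) simp_all
      have "card S = length bs + 2" "length ps = length bs"
        using len 3 l by (auto simp: ps_def)
      then show "length (ladder c ((b, a) # ps) t @ ladder c ps a) \<le> 4 * card S + 1"
        by (simp add: length_ladder)
      have "fst ` set ps = set bs" using fst by (metis list.set_map)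
      then have "insert c (insert b (fst ` set ps)) = S" using cs 3 by auto
      then show "run (ladder c ((b, a) # ps) t @ ladder c ps a) s = mcx S t s" for s
        using run_ladder_twice[OF dist] by simp
    qed
  qed
qed

text \<open>A commutator: \<open>d\<close> is toggled by the conjunction over \<open>S1\<close>,
  \<open>t\<close> by that of \<open>d\<close> and \<open>S2\<close>, and both are done twice. This
  restores \<open>d\<close> and leaves on \<open>t\<close> the conjunction over all of
  \<open>S\<close>. Each half lends its lines to the circuit of the other.\<close>

lemma mcx_circuit_one_borrowed:
  assumes "S \<subseteq> {..<m}" "t < m" "t \<notin> S" "d < m" "d \<notin> insert t S"
  obtains C where "valid_circuit m C" "length C \<le> 8 * card S + 12" "\<And>s. run C s = mcx S t s"
proof -
  have fin: "finite S" using assms finite_subset by blast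
  \<comment> \<open>Rounding up makes \<open>S1\<close> at least as large as \<open>S2\<close>: the
    second circuit has the extra control \<open>d\<close> and borrows from \<open>S1\<close>
    alone.\<close>
  obtain S1 where S1: "S1 \<subseteq> S" "card S1 = (card S + 1) div 2"
    by (rule obtain_subset_with_card_n[of "(card S + 1) div 2" S]) auto
  define S2 where "S2 = S - S1"
  have S2: "card S2 = card S - (card S + 1) div 2" "S1 \<inter> S2 = {}" "S1 \<union> S2 = S"
    using S1 fin by (auto simp: S2_def card_Diff_subset finite_subset)
  have f: "finite S1" "finite S2" "t \<notin> S2" "d \<notin> S2" using S1 S2 fin assms by (auto intro: finite_subset)
  obtain C1 where C1: "valid_circuit m C1" "length C1 \<le> 4 * card S1 + 1" "\<And>s. run C1 s = mcx S1 d s"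
    by (rule mcx_circuit_many_borrowed[of S1 m d "insert t S2"])
       (use assms S1 S2 f in \<open>auto\<close>)
  obtain C2 where C2: "valid_circuit m C2" "length C2 \<le> 4 * card (insert d S2) + 1"
      "\<And>s. run C2 s = mcx (insert d S2) t s"
    by (rule mcx_circuit_many_borrowed[of "insert d S2" m t S1])
       (use assms S1 S2 f in \<open>auto\<close>)
  show thesis
  proof (rule that[of "C1 @ C2 @ C1 @ C2"])
    show "valid_circuit m (C1 @ C2 @ C1 @ C2)" using C1 C2 by simp
    show "length (C1 @ C2 @ C1 @ C2) \<le> 8 * card S + 12"
      using C1(2) C2(2) f S1(2) S2(1) by simp
    have T: "S1 \<subseteq> flip u p s \<longleftrightarrow> S1 \<subseteq> s" "S2 \<subseteq> flip u p s \<longleftrightarrow> S2 \<subseteq> s"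
        "d \<in> flip u p s \<longleftrightarrow> (d \<in> s) \<noteq> (u = d \<and> p)"
      if "u = d \<or> u = t" for u p s
      using that assms S1(1) S2(3) by (auto simp: flip_def)
    show "run (C1 @ C2 @ C1 @ C2) s = mcx S t s" for s
    proof -
      have "d \<noteq> t" using assms by auto
      have "run (C1 @ C2 @ C1 @ C2) s
          = flip t (((d \<in> s) \<noteq> (S1 \<subseteq> s)) \<and> S2 \<subseteq> s) (flip t (d \<in> s \<and> S2 \<subseteq> s) s)"
        unfolding run_append C1 C2 mcx_def flip_def[symmetric] insert_subset
        using \<open>d \<noteq> t\<close> by (auto simp: T) (auto simp: flip_def)
      also have "\<dots> = mcx S t s"
        unfolding S2(3)[symmetric] by (auto simp: flip_def mcx_def)
      finally show ?thesis .
    qed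
  qed
qed

text \<open>Conjugation by NOTs on \<open>S - v\<close> turns the pattern \<open>v\<close> into all
  ones on \<open>S\<close>; the line \<open>t\<close> lies outside \<open>S\<close> and is left
  alone by them.\<close>

lemma pattern_flip_circuit:
  assumes "valid_circuit m C" "\<And>s. run C s = mcx S t s" "S \<subseteq> {..<m}" "t \<notin> S" "v \<subseteq> S"
  obtains C' where "valid_circuit m C'" "length C' \<le> length C + 2 * card S"
    "\<And>s. run C' s = {i. (i \<in> s) \<noteq> (i = t \<and> s \<inter> S = v)}"
proof -
  obtain N where N: "valid_circuit m N" "length N = card (S - v)"
      "\<And>s. run N s = {i. (i \<in> s) \<noteq> (i \<in> S - v)}"
    by (rule nots_circuit[of "S - v" m]) (use assms in auto)
  have "card (S - v) \<le> card S"
    using assms(3) finite_subset by (intro card_mono) blast+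
  show thesis
  proof (rule that[of "N @ C @ N"])
    show "valid_circuit m (N @ C @ N)" using N assms by simp
    show "length (N @ C @ N) \<le> length C + 2 * card S"
      using N \<open>card (S - v) \<le> card S\<close> by simp
    have "S \<subseteq> {i. (i \<in> s) \<noteq> (i \<in> S - v)} \<longleftrightarrow> s \<inter> S = v" for s
      using assms by auto
    then show "run (N @ C @ N) s = {i. (i \<in> s) \<noteq> (i = t \<and> s \<inter> S = v)}" for s
      unfolding run_append N assms(2) mcx_def using assms by auto
  qed
qed

section \<open>Simultaneous transpositions\<close>

text \<open>CNOTs from \<open>t\<close>, a line where \<open>w\<close> and \<open>p\<close> differ,
  fix \<open>w\<close> and carry \<open>p\<close> to \<open>insert t w\<close>; toggling
  \<open>t\<close> on the pattern \<open>w\<close> then swaps the two. The pattern is read on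
  \<open>R\<close> only, so the claim is limited to states inside \<open>R\<close>, while the lines
  outside \<open>R\<close> can be borrowed.\<close>

lemma transposition_circuit_aux:
  assumes R: "R \<subseteq> {..<m}" "2 * card R \<le> m" and w: "w \<subseteq> R" "p \<subseteq> R" "t \<in> p" "t \<notin> w"
  obtains C where "valid_circuit m C" "length C \<le> 8 * card R"
    "\<And>s. s \<subseteq> R \<Longrightarrow> run C s = transpose w p s"
proof -
  have fin: "finite R" and "t \<in> R" using R w finite_subset by blast+
  define r where "r = card (R - {t})"
  have r: "card R = Suc r" unfolding r_def using card.remove[OF fin \<open>t \<in> R\<close>] .
  define J where "J = {j \<in> R - {t}. (j \<in> w) \<noteq> (j \<in> p)}"
  have "card J \<le> r" unfolding r_def J_def using fin by (intro card_mono) auto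
  obtain N where N: "valid_circuit m N" "length N = card J"
      "\<And>s. run N s = {i. (i \<in> s) \<noteq> (i \<in> J \<and> t \<in> s)}"
    by (rule cnots_circuit[of J m "\<lambda>_. t"]) (use R \<open>t \<in> R\<close> in \<open>auto simp: J_def\<close>)
  obtain C0 where C0: "valid_circuit m C0" "length C0 \<le> 4 * r + 1" "\<And>s. run C0 s = mcx (R - {t}) t s"
  proof (rule mcx_circuit_many_borrowed[of "R - {t}" m t "{..<m} - R"])
    have "card ({..<m} - R) = m - card R" using R fin by (simp add: card_Diff_subset)
    then show "card (R - {t}) \<le> card ({..<m} - R) + 1" using R r unfolding r_def by simp
  qed (use R \<open>t \<in> R\<close> in \<open>auto simp: r_def\<close>)
  obtain C1 where C1: "valid_circuit m C1" "length C1 \<le> length C0 + 2 * r"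
      "\<And>s. run C1 s = {i. (i \<in> s) \<noteq> (i = t \<and> s \<inter> (R - {t}) = w)}"
    by (rule pattern_flip_circuit[OF C0(1) C0(3), of w]) (use R w in \<open>auto simp: r_def\<close>)
  show thesis
  proof (rule that[of "N @ C1 @ N"])
    show "valid_circuit m (N @ C1 @ N)" using N C1 by simp
    show "length (N @ C1 @ N) \<le> 8 * card R" using N C1 C0 r \<open>card J \<le> r\<close> by simp
    show "run (N @ C1 @ N) s = transpose w p s" if "s \<subseteq> R" for s
    proof -
      have NN: "run N (run N s) = s" unfolding N by (auto simp: J_def)
      have NNp: "run N (run N p) = p" unfolding N by (auto simp: J_def)
      have Nw: "run N w = w" unfolding N using w by auto
      have Np: "run N p = insert t w" unfolding N using w by (auto simp: J_def)
      have "run N s \<subseteq> R" unfolding N using that by (auto simp: J_def)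
      then have "run N s \<inter> (R - {t}) = w \<longleftrightarrow> run N s = run N w \<or> run N s = run N p"
        unfolding Nw Np using w by auto
      then have *: "run N s \<inter> (R - {t}) = w \<longleftrightarrow> s = w \<or> s = p"
        using run_inject[OF N(1)] by simp
      consider "s = w" | "s = p" | "s \<noteq> w" "s \<noteq> p" by blast
      then show ?thesis
      proof cases
        case 1
        have "run C1 w = insert t w" unfolding C1 using w by auto
        then show ?thesis using 1 Nw Np NNp by simp
      next
        case 2
        have "run C1 (insert t w) = w" unfolding C1 using w by auto
        then show ?thesis using 2 Nw Np by simp
      next
        case 3
        then have "run C1 (run N s) = run N s" unfolding C1 using * by auto
        then show ?thesis using NN 3 by simp
      qed
    qed
  qed
qed

lemma transposition_circuit:
  assumes R: "R \<subseteq> {..<m}" "2 * card R \<le> m" and w: "w \<subseteq> R" "p \<subseteq> R"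
  obtains C where "valid_circuit m C" "length C \<le> 8 * card R"
    "\<And>s. s \<subseteq> R \<Longrightarrow> run C s = transpose w p s"
proof -
  consider "w = p" | t where "t \<in> p" "t \<notin> w" | t where "t \<in> w" "t \<notin> p" by blast
  then show thesis
  proof cases
    case 1
    then show thesis by (intro that[of "[]"]) auto
  next
    case 2
    then show thesis using transposition_circuit_aux[OF R w] that by blast
  next
    case 3
    then show thesis
      using transposition_circuit_aux[OF R w(2) w(1)] that by (metis transpose_commute)
  qed
qed

text \<open>Points are placed one at a time by swapping the current position of \<open>z\<close>
  with \<open>e z\<close>. Points already placed stay, since injectivity keeps them off both swapped
  states. Invariance of the subsets of \<open>R\<close> is carried along because the transposition
  circuits are only claimed correct there.\<close>

lemma relocation_circuit:
  assumes R: "R \<subseteq> {..<m}" "2 * card R \<le> m"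
    and Z: "finite Z" "\<And>z. z \<in> Z \<Longrightarrow> z \<subseteq> R" "\<And>z. z \<in> Z \<Longrightarrow> e z \<subseteq> R" "inj_on e Z"
  shows "\<exists>C. valid_circuit m C \<and> length C \<le> card Z * (8 * card R) \<and>
    (\<forall>s\<subseteq>R. run C s \<subseteq> R) \<and> (\<forall>z\<in>Z. run C z = e z)"
  using Z
proof (induction Z rule: finite_induct)
  case empty
  then show ?case by (intro exI[of _ "[]"]) auto
next
  case (insert z Z)
  then obtain C where C: "valid_circuit m C" "length C \<le> card Z * (8 * card R)"
      "\<And>s. s \<subseteq> R \<Longrightarrow> run C s \<subseteq> R" "\<And>z. z \<in> Z \<Longrightarrow> run C z = e z"
    by (metis inj_on_insert insertCI)
  obtain C' where C': "valid_circuit m C'" "length C' \<le> 8 * card R"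
      "\<And>s. s \<subseteq> R \<Longrightarrow> run C' s = transpose (run C z) (e z) s"
    by (rule transposition_circuit[OF R, of "run C z" "e z"]) (use C(3) insert.prems in auto)
  have 1: "run C' (run C z') = e z'" if "z' \<in> insert z Z" for z'
  proof (cases "z' = z")
    case True
    then show ?thesis using C'(3) C(3) insert.prems by simp
  next
    case False
    then have z': "z' \<in> Z" using that by simp
    have "e z' \<noteq> e z" using False z' insert.prems by (auto simp: inj_on_def)
    moreover have "e z' \<noteq> run C z" using C(4)[OF z'] run_inject[OF C(1)] False by metis
    ultimately show ?thesis using C(4)[OF z'] C'(3) insert.prems z' by simp
  qed
  have 2: "run C' (run C s) \<subseteq> R" if "s \<subseteq> R" for s
  proof -
    have "run C' (run C s) \<in> {run C z, e z, run C s}"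
      using C'(3)[OF C(3)[OF that]] by (auto simp: transpose_def)
    moreover have "run C z \<subseteq> R" "e z \<subseteq> R" "run C s \<subseteq> R"
      using C(3) that insert.prems by simp_all
    ultimately show ?thesis by auto
  qed
  show ?case
    by (rule exI[of _ "C @ C'"]) (use C C' 1 2 insert.hyps in auto)
qed

text \<open>View the elements of \<open>Z\<close> as the rows of a matrix. A line whose column
  equals that of its representative is cleared on all of \<open>Z\<close> by one CNOT, and there are
  at most \<open>2 ^ card Z\<close> columns. The first \<open>k\<close> lines are retained as room
  for the later subcube.\<close>

lemma column_reduction:
  fixes Z :: "nat set set"
  assumes Z: "finite Z" "\<And>z. z \<in> Z \<Longrightarrow> z \<subseteq> {..<m}" and k: "k \<le> m"
  obtains R C where "{..<k} \<subseteq> R" "R \<subseteq> {..<m}" "card R \<le> 2 ^ card Z + k"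
    "valid_circuit m C" "length C \<le> m" "\<And>z. z \<in> Z \<Longrightarrow> run C z \<subseteq> R"
proof -
  define col where "col j = {z \<in> Z. j \<in> z}" for j
  define rep where "rep j = (LEAST i. col i = col j)" for j
  have col_rep: "col (rep j) = col j" for j
    unfolding rep_def by (rule LeastI[of "\<lambda>i. col i = col j" j]) simp
  have rep_le: "rep j \<le> j" for j
    unfolding rep_def by (rule Least_le) simp
  define R where "R = rep ` {..<m} \<union> {..<k}"
  have "rep ` {..<m} = (\<lambda>c. LEAST i. col i = c) ` col ` {..<m}"
    by (simp add: rep_def image_image)
  then have "card (rep ` {..<m}) \<le> card (col ` {..<m})" by (metis card_image_le finite_imageI finite_lessThan)
  also have "\<dots> \<le> card (Pow Z)" using Z(1) by (intro card_mono) (auto simp: col_def)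
  finally have cardR: "card R \<le> 2 ^ card Z + k"
    using card_Un_le[of "rep ` {..<m}" "{..<k}"] using Z(1) by (simp add: R_def card_Pow)
  have Rm: "R \<subseteq> {..<m}" 
    unfolding R_def using k by (auto intro: le_less_trans[OF rep_le])
  obtain C where C: "valid_circuit m C" "length C = card ({..<m} - R)"
      "\<And>s. run C s = {i. (i \<in> s) \<noteq> (i \<in> {..<m} - R \<and> rep i \<in> s)}"
    by (rule cnots_circuit[of "{..<m} - R" m rep]) (use Rm in \<open>auto simp: R_def\<close>)
  have "card ({..<m} - R) \<le> m" using card_mono[of "{..<m}" "{..<m} - R"] by simp
  moreover have "run C z \<subseteq> R" if "z \<in> Z" for z
  proof -
    have "rep i \<in> z \<longleftrightarrow> i \<in> z" for i using col_rep[of i] that by (auto simp: col_def)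
    then show ?thesis unfolding C using Z(2)[OF that] by auto
  qed
  ultimately show thesis using that[of R C] cardR Rm C by (auto simp: R_def)
qed

text \<open>On the points of the given pairs, all but a few lines can be cleared by CNOT gates because
  equal columns cancel. The points are then moved to the subsets of \<open>{..k}\<close>, paired along
  line \<open>k\<close>, where a single gate performs all transpositions at once.\<close>

lemma transpositions_circuit:
  fixes S :: "nat set set"
  assumes S: "card S = 2 ^ k" "S \<subseteq> Pow {..<m}" and h: "h ` S \<subseteq> Pow {..<m}" "inj_on h S" "S \<inter> h ` S = {}"
    and k: "0 < k" and m: "4 * 4 ^ 2 ^ k \<le> m"
  obtains C where "valid_circuit m C" "length C \<le> 12 * m + 12 + 64 * 2 ^ k * 4 ^ 2 ^ k"
    "\<And>x. x \<in> S \<Longrightarrow> run C x = h x" "\<And>x. x \<in> S \<Longrightarrow> run C (h x) = x"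
    "\<And>s. s \<subseteq> {..<m} \<Longrightarrow> s \<notin> S \<Longrightarrow> s \<notin> h ` S \<Longrightarrow> run C s = s"
proof -
  define K :: nat where "K = 2 ^ k"
  have finS: "finite S" using S card.infinite by fastforce
  define Z where "Z = S \<union> h ` S"
  have cardZ: "card Z = 2 * K"
    unfolding Z_def using finS h S by (simp add: card_Un_disjoint card_image K_def)
  have finZ: "finite Z" using finS by (simp add: Z_def)
  have kK: "k + 1 \<le> K" unfolding K_def using less_exp[of k] by (simp only: Suc_eq_plus1[symmetric] Suc_le_eq)
  have K4: "K \<le> 4 ^ K"
  proof -
    have "K < 2 ^ K" by (rule less_exp)
    also have "(2::nat) ^ K \<le> 4 ^ K" by (rule power_mono) auto
    finally show ?thesis by simp
  qed
  have km: "k + 1 \<le> m" using kK K4 m unfolding K_def by linarith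
  obtain R A where R: "{..<k + 1} \<subseteq> R" "R \<subseteq> {..<m}" "card R \<le> 2 ^ card Z + (k + 1)"
      and A: "valid_circuit m A" "length A \<le> m" "\<And>z. z \<in> Z \<Longrightarrow> run A z \<subseteq> R"
    by (rule column_reduction[OF finZ _ km]) (use S(2) h(1) in \<open>auto simp: Z_def\<close>)
  have "(2::nat) ^ card Z = 4 ^ K" by (simp add: cardZ power_mult)
  then have cR: "card R \<le> 2 * 4 ^ K" using R(3) kK K4 by linarith
  have "card (Pow {..<k}) = card S" by (simp add: card_Pow S)
  then obtain u where u: "bij_betw u S (Pow {..<k})"
    using finite_same_card_bij[OF finS, of "Pow {..<k}"] by auto
  \<comment> \<open>Since \<open>card S\<close> is a power of two, the goals fill the subcube of
    subsets of \<open>{..k}\<close> exactly, and \<open>h\<close> becomes the toggle of line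
    \<open>k\<close>. No other state can enter the subcube, so the single gate moves nothing
    else.\<close>
  define e0 where "e0 z = (if z \<in> S then u z else insert k (u (the_inv_into S h z)))" for z
  have e0S: "e0 x = u x" if "x \<in> S" for x using that by (simp add: e0_def)
  have e0h: "e0 (h x) = insert k (u x)" if "x \<in> S" for x
    using that h by (auto simp: e0_def the_inv_into_f_f)
  have uk: "u x \<subseteq> {..<k}" if "x \<in> S" for x using bij_betwE[OF u] that by auto
  have uinj: "u x = u y \<longleftrightarrow> x = y" if "x \<in> S" "y \<in> S" for x y
    using u that by (auto simp: bij_betw_def inj_on_def)
  have e0R: "e0 z \<subseteq> {..k}" if "z \<in> Z" for z
    using that uk e0S e0h by (fastforce simp: Z_def)
  have iffk: "insert k X = insert k Y \<longleftrightarrow> X = Y" "insert k X \<noteq> Y" "Y \<noteq> insert k X"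
    if "X \<subseteq> {..<k}" "Y \<subseteq> {..<k}" for X Y :: "nat set"
    using that by (auto simp: insert_ident)
  have e0inj: "inj_on e0 Z"
    by (rule inj_onI) (auto simp: Z_def e0S e0h uinj iffk uk)
  define e where "e w = e0 (run (rev A) w)" for w
  have eA: "e (run A z) = e0 z" for z by (simp add: e_def run_rev[OF A(1)])
  have injA: "inj_on (run A) Z" using run_inject[OF A(1)] by (auto simp: inj_on_def)
  have eR: "e0 z \<subseteq> R" if "z \<in> Z" for z using e0R[OF that] R(1) by (force simp: lessThan_Suc_atMost)
  have "\<exists>B. valid_circuit m B \<and> length B \<le> card (run A ` Z) * (8 * card R) \<and>
      (\<forall>s\<subseteq>R. run B s \<subseteq> R) \<and> (\<forall>z\<in>run A ` Z. run B z = e z)"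
  proof (rule relocation_circuit[OF R(2)])
    show "2 * card R \<le> m" using cR m by (simp add: K_def)
    show "finite (run A ` Z)" using finZ by simp
    show "w \<subseteq> R" "e w \<subseteq> R" if "w \<in> run A ` Z" for w
      using that A(3) eR by (force simp: eA)+
    show "inj_on e (run A ` Z)"
      using e0inj by (auto simp: inj_on_def eA)
  qed
  then obtain B where B: "valid_circuit m B" "length B \<le> card (run A ` Z) * (8 * card R)"
      "\<And>z. z \<in> Z \<Longrightarrow> run B (run A z) = e0 z"
    by (auto simp: eA)
  have "length B \<le> 2 * K * (8 * (2 * 4 ^ K))"
    unfolding cardZ[symmetric] card_image[OF injA, symmetric]
    by (rule order_trans[OF B(2)]) (use cR in simp)
  then have lenB: "length B \<le> 32 * K * 4 ^ K" by simp
  define T where "T = {k<..<m}"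
  have Tm: "card T \<le> m" unfolding T_def by simp
  obtain M0 where M0: "valid_circuit m M0" "length M0 \<le> 8 * card T + 12" "\<And>s. run M0 s = mcx T k s"
    by (rule mcx_circuit_one_borrowed[of T m k 0]) (use k km in \<open>auto simp: T_def\<close>)
  obtain M where M: "valid_circuit m M" "length M \<le> length M0 + 2 * card T"
      "\<And>s. run M s = {i. (i \<in> s) \<noteq> (i = k \<and> s \<inter> T = {})}"
    by (rule pattern_flip_circuit[OF M0(1) M0(3), of "{}"]) (auto simp: T_def)
  let ?C = "A @ B @ M @ rev B @ rev A"
  have ret: "run (rev A) (run (rev B) (e0 z)) = z" if "z \<in> Z" for z
    using B(3)[OF that, symmetric] run_rev[OF A(1)] run_rev[OF B(1)] by simp
  have MS: "run M (u x) = insert k (u x)" "run M (insert k (u x)) = u x" if "x \<in> S" for x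
    unfolding M using uk[OF that] by (auto simp: T_def)
  show thesis
  proof (rule that[of ?C])
    show "valid_circuit m ?C" using A B M by simp
    \<comment> \<open>Two copies of \<open>A\<close> cost at most \<open>2 * m\<close>,
      \<open>M\<close> at most \<open>10 * m + 12\<close>, and two copies of \<open>B\<close> give
      the last term.\<close>
    show "length ?C \<le> 12 * m + 12 + 64 * 2 ^ k * 4 ^ 2 ^ k"
      using A(2) lenB M(2) M0(2) Tm by (simp add: K_def)
    show "run ?C x = h x" if "x \<in> S" for x
      using B(3)[of x] ret[of "h x"] MS[OF that] that by (simp add: Z_def e0S e0h)
    show "run ?C (h x) = x" if "x \<in> S" for x
      using B(3)[of "h x"] ret[of "x"] MS[OF that] that by (simp add: Z_def e0S e0h)
    show "run ?C s = s" if s: "s \<subseteq> {..<m}" "s \<notin> S" "s \<notin> h ` S" for s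
    proof -
      define s' where "s' = run B (run A s)"
      have s'm: "s' \<subseteq> {..<m}" unfolding s'_def using run_Pow A(1) B(1) s(1) by blast
      have ne: "s' \<noteq> e0 z" if "z \<in> Z" for z
        using B(3)[OF that] run_inject[OF A(1)] run_inject[OF B(1)] s that unfolding s'_def Z_def by (metis UnE)
      have "s' \<inter> T \<noteq> {}"
      proof
        assume "s' \<inter> T = {}"
        then have "s' - {k} \<subseteq> {..<k}" 
          using s'm unfolding T_def by (auto simp: disjoint_iff subset_iff)
        then obtain x where x: "x \<in> S" "s' - {k} = u x"
          using u by (metis (no_types, lifting) Pow_iff bij_betw_imp_surj_on imageE)
        then have "s' = u x \<or> s' = insert k (u x)" by auto
        then show False
          using ne[of x] ne[of "h x"] e0S[OF x(1)] e0h[OF x(1)] x(1) by (auto simp: Z_def)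
      qed
      then have "run M s' = s'" unfolding M by auto
      then show ?thesis by (simp add: s'_def run_rev[OF A(1)] run_rev[OF B(1)])
    qed
  qed
qed

section \<open>Parity\<close>

text \<open>\<open>evenperm\<close> concerns permutations of a whole type, so the action is
  continued by the identity beyond the states on the first \<open>m\<close> lines.\<close>

definition on_lines :: "nat \<Rightarrow> (nat set \<Rightarrow> nat set) \<Rightarrow> nat set \<Rightarrow> nat set" where
  "on_lines m f s = (if s \<subseteq> {..<m} then f s else s)"

text \<open>The number of controls is left open because the parity argument adds one more control to
  a gate that may already have two.\<close>

lemma permutation_gate:
  assumes "j < m" "j \<notin> set cs"
  shows "permutation (on_lines m (gate_act (Gate cs j)))"
proof -
  let ?f = "on_lines m (gate_act (Gate cs j))"
  have inv: "?f (?f s) = s" for s using assms by (auto simp: on_lines_def)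
  have P: "?f s \<subseteq> {..<m}" if "s \<subseteq> {..<m}" for s using assms that by (auto simp: on_lines_def)
  have "bij_betw ?f (Pow {..<m}) (Pow {..<m})"
    using inv P by (intro bij_betw_byWitness[where f' = ?f]) auto
  then have "?f permutes Pow {..<m}"
    by (rule bij_imp_permutes) (auto simp: on_lines_def)
  then show ?thesis by (intro permutes_imp_permutation[of "Pow {..<m}"]) auto
qed

text \<open>A gate that ignores line \<open>l\<close> is the product of its restrictions to the states with and
  without \<open>l\<close>; these are conjugate, so they have the same sign.\<close>

lemma evenperm_gate:
  assumes "valid_gate m g" "4 \<le> m"
  shows "evenperm (on_lines m (gate_act g))"
proof -
  obtain cs j where g: "g = Gate cs j" by (cases g)
  have cs: "length cs \<le> 2" "j < m" "j \<notin> set cs" using assms g by auto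
  \<comment> \<open>A gate touches at most three lines, so \<open>4 \<le> m\<close> leaves a line
    \<open>l\<close> that it ignores.\<close>
  have "card (insert j (set cs)) \<le> 3"
    using card_insert_le_m1[of 3 "set cs" j] card_length[of cs] cs by simp
  then have "card (insert j (set cs)) < card {..<m}" using assms(2) by simp
  then obtain l where l: "l < m" "l \<noteq> j" "l \<notin> set cs"
    by (metis (no_types, lifting) List.finite_set card_mono finite_insert insertCI lessThan_iff linorder_not_less subsetI)
  define A where "A = on_lines m (gate_act (Gate (l # cs) j))"
  define X where "X = on_lines m (gate_act (Gate [] l))"
  have A: "permutation A" unfolding A_def using cs l by (intro permutation_gate) auto
  have X: "permutation X" unfolding X_def using l by (intro permutation_gate) auto
  have Xs: "X s = flip l True s" and As: "A s = flip j (l \<in> s \<and> set cs \<subseteq> s) s" if "s \<subseteq> {..<m}" for s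
    using that by (auto simp: A_def X_def on_lines_def flip_def)
  have flipP: "flip i p s \<subseteq> {..<m}" if "s \<subseteq> {..<m}" "i < m" for i p s
    using that by (auto simp: flip_def)
  have "on_lines m (gate_act g) s = A (X (A (X s)))" for s
  proof (cases "s \<subseteq> {..<m}")
    case True
    have "set cs \<subseteq> flip l True s \<longleftrightarrow> set cs \<subseteq> s" "l \<in> flip l True s \<longleftrightarrow> l \<notin> s"
      using l by (auto simp: flip_def)
    then have "A (X s) = flip j (l \<notin> s \<and> set cs \<subseteq> s) (flip l True s)"
      using Xs[OF True] As[OF flipP[OF True l(1)]] by simp
    then have "X (A (X s)) = flip l True (flip j (l \<notin> s \<and> set cs \<subseteq> s) (flip l True s))"
      using Xs flipP True l cs by simp
    also have "\<dots> = flip j (l \<notin> s \<and> set cs \<subseteq> s) s"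
      using l by (auto simp: flip_def)
    finally have 1: "X (A (X s)) = flip j (l \<notin> s \<and> set cs \<subseteq> s) s" .
    have "set cs \<subseteq> flip j p s \<longleftrightarrow> set cs \<subseteq> s" "l \<in> flip j p s \<longleftrightarrow> l \<in> s" for p
      using l cs by (auto simp: flip_def)
    then have "A (X (A (X s))) = flip j (l \<in> s \<and> set cs \<subseteq> s) (flip j (l \<notin> s \<and> set cs \<subseteq> s) s)"
      unfolding 1 using As[OF flipP[OF True cs(2)]] by simp
    also have "\<dots> = on_lines m (gate_act g) s"
      using True by (auto simp: flip_def on_lines_def g)
    finally show ?thesis by simp
  qed (simp add: A_def X_def on_lines_def)
  then have "on_lines m (gate_act g) = A \<circ> (X \<circ> (A \<circ> X))" by auto
  then show ?thesis
    using A X by (cases "evenperm A"; cases "evenperm X") (simp_all add: evenperm_comp permutation_compose)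
qed

lemma evenperm_run:
  assumes "valid_circuit m C" "4 \<le> m"
  shows "permutation (on_lines m (run C)) \<and> evenperm (on_lines m (run C))"
  using assms(1)
proof (induction C)
  case Nil
  have "on_lines m (run []) = id" by (auto simp: on_lines_def fun_eq_iff)
  then show ?case using permutation_id evenperm_id by metis
next
  case (Cons g C)
  have "on_lines m (run (g # C)) = on_lines m (run C) \<circ> on_lines m (gate_act g)"
    using Cons.prems by (auto simp: fun_eq_iff on_lines_def gate_act_Pow dest: gate_act_Pow)
  moreover have "permutation (on_lines m (gate_act g))"
    using Cons.prems permutation_gate by (cases g) auto
  moreover have "evenperm (on_lines m (gate_act g))"
    using Cons.prems assms(2) by (intro evenperm_gate) auto
  ultimately show ?case
    using Cons by (metis evenperm_comp permutation_compose valid_circuit_Cons)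
qed

lemma run_ne_transposition:
  assumes "valid_circuit m C" "4 \<le> m" "x \<subseteq> {..<m}" "y \<subseteq> {..<m}" "x \<noteq> y"
  shows "\<exists>s\<subseteq>{..<m}. run C s \<noteq> transpose x y s"
proof (rule ccontr)
  assume "\<not> ?thesis"
  then have "on_lines m (run C) = transpose x y"
    using assms(3,4) by (auto simp: on_lines_def fun_eq_iff transpose_def)
  then show False
    using evenperm_run[OF assms(1,2)] assms(5) by (simp add: evenperm_swap)
qed

section \<open>Realising a bijection on a set of inputs\<close>

text \<open>Greedy choice: each selected point rules out only itself, its image and its preimage,
  hence the factor 3.\<close>

lemma disjoint_batch:
  assumes "finite B" "inj_on g B" "\<And>x. x \<in> B \<Longrightarrow> g x \<noteq> x" "3 * K \<le> card B"
  shows "\<exists>S\<subseteq>B. card S = K \<and> S \<inter> g ` S = {}"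
  using assms(4)
proof (induction K)
  case 0
  show ?case by (rule exI[of _ "{}"]) auto
next
  case (Suc K)
  then obtain S where S: "S \<subseteq> B" "card S = K" "S \<inter> g ` S = {}" by auto
  have finS: "finite S" using S assms(1) finite_subset by blast
  let ?V = "{x \<in> B. g x \<in> S}"
  have "card ?V \<le> K"
    using card_inj_on_le[of g ?V S] assms(2) finS S by (auto simp: inj_on_def)
  moreover have "card (g ` S) \<le> K" using card_image_le[OF finS, of g] S by simp
  ultimately have "card (S \<union> g ` S \<union> ?V) \<le> 3 * K"
    using card_Un_le[of "S \<union> g ` S" ?V] card_Un_le[of S "g ` S"] S(2) by linarith
  then have "card (S \<union> g ` S \<union> ?V) < card B" using Suc.prems by simp
  moreover have "finite (S \<union> g ` S \<union> ?V)" using finS assms(1) by simp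
  ultimately obtain x where x: "x \<in> B" "x \<notin> S \<union> g ` S \<union> ?V"
    by (meson card_mono linorder_not_less subsetI)
  show ?case
  proof (intro exI[of _ "insert x S"] conjI)
    show "insert x S \<inter> g ` insert x S = {}" using x S assms(3)[OF x(1)] by auto
  qed (use x S finS in auto)
qed

text \<open>The case \<open>k = 1\<close> of the batch circuit: \<open>64 = 4 * 4 ^ 2\<close> and
  \<open>2060 = 12 + 64 * 2 * 16\<close>.\<close>

lemma double_transposition_circuit:
  assumes "64 \<le> m" "distinct [a, b, u, v]" "{a, b, u, v} \<subseteq> Pow {..<m}"
  obtains C where "valid_circuit m C" "length C \<le> 12 * m + 2060"
    "run C a = b" "run C b = a" "run C u = v" "run C v = u"
    "\<And>s. s \<subseteq> {..<m} \<Longrightarrow> s \<notin> {a, b, u, v} \<Longrightarrow> run C s = s"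
proof -
  define h where "h x = (if x = a then b else v)" for x
  obtain C where C: "valid_circuit m C" "length C \<le> 12 * m + 12 + 64 * 2 ^ 1 * 4 ^ 2 ^ 1"
    "\<And>x. x \<in> {a, u} \<Longrightarrow> run C x = h x" "\<And>x. x \<in> {a, u} \<Longrightarrow> run C (h x) = x"
    "\<And>s. s \<subseteq> {..<m} \<Longrightarrow> s \<notin> {a, u} \<Longrightarrow> s \<notin> h ` {a, u} \<Longrightarrow> run C s = s"
    by (rule transpositions_circuit[of "{a, u}" 1 m h]) (use assms in \<open>auto simp: h_def\<close>)
  have h: "h a = b" "h u = v" using assms(2) by (auto simp: h_def)
  show thesis
  proof (rule that[of C])
    show "run C a = b" "run C u = v" "run C b = a" "run C v = u"
      using C(3)[of a] C(3)[of u] C(4)[of a] C(4)[of u] h by simp_all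
    show "run C s = s" if "s \<subseteq> {..<m}" "s \<notin> {a, b, u, v}" for s
      using that h by (intro C(5)) auto
  qed (use C(1,2) in simp_all)
qed

text \<open>A 3-cycle is the product of the transpositions of \<open>a, b\<close> and of
  \<open>a, c\<close>. Each alone is odd and has no circuit, so both are accompanied by the same
  auxiliary swap of \<open>u, v\<close>, which cancels.\<close>

lemma three_cycle_circuit:
  assumes "64 \<le> m" "distinct [a, b, c]" "{a, b, c} \<subseteq> Pow {..<m}"
  obtains C where "valid_circuit m C" "length C \<le> 24 * m + 4120"
    "run C a = b" "run C b = c" "run C c = a"
    "\<And>s. s \<subseteq> {..<m} \<Longrightarrow> s \<notin> {a, b, c} \<Longrightarrow> run C s = s"
proof -
  have "(64::nat) < 2 ^ 64" by simp
  also have "(2::nat) ^ 64 \<le> 2 ^ m" using assms(1) by (intro power_increasing) auto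
  finally have big: "64 < card (Pow {..<m})" by (simp add: card_Pow)
  have "card {a, b, c} \<le> 3" by (simp add: card_insert_if)
  then have "card (Pow {..<m} - {a, b, c}) \<ge> 2"
    using big diff_card_le_card_Diff[of "{a, b, c}" "Pow {..<m}"] by simp
  then obtain W where W: "W \<subseteq> Pow {..<m} - {a, b, c}" "card W = 2"
    using obtain_subset_with_card_n by meson
  then obtain u v where uv: "W = {u, v}" "u \<noteq> v" by (meson card_2_iff)
  obtain C1 where C1: "valid_circuit m C1" "length C1 \<le> 12 * m + 2060"
    "run C1 a = b" "run C1 b = a" "run C1 u = v" "run C1 v = u"
    "\<And>s. s \<subseteq> {..<m} \<Longrightarrow> s \<notin> {a, b, u, v} \<Longrightarrow> run C1 s = s"
    by (rule double_transposition_circuit[of m a b u v]) (use assms W uv in auto)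
  obtain C2 where C2: "valid_circuit m C2" "length C2 \<le> 12 * m + 2060"
    "run C2 a = c" "run C2 c = a" "run C2 u = v" "run C2 v = u"
    "\<And>s. s \<subseteq> {..<m} \<Longrightarrow> s \<notin> {a, c, u, v} \<Longrightarrow> run C2 s = s"
    by (rule double_transposition_circuit[of m a c u v]) (use assms W uv in auto)
  show thesis
  proof (rule that[of "C1 @ C2"])
    have uv': "u \<notin> {a, b, c}" "v \<notin> {a, b, c}" using W(1) uv(1) by auto
    have "run C2 b = b" by (rule C2(7)) (use assms(2,3) uv' in auto)
    then show "run (C1 @ C2) a = b" using C1(3) by simp
    have "run C1 c = c" by (rule C1(7)) (use assms(2,3) uv' in auto)
    then show "run (C1 @ C2) c = a" using C2(4) by simp
    show "run (C1 @ C2) s = s" if s: "s \<subseteq> {..<m}" "s \<notin> {a, b, c}" for s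
    proof (cases "s \<in> {u, v}")
      case True
      then show ?thesis using C1(5,6) C2(5,6) by auto
    next
      case False
      then have "run C1 s = s" "run C2 s = s" using C1(7)[of s] C2(7)[of s] s by auto
      then show ?thesis by simp
    qed
  qed (use C1 C2 in auto)
qed

text \<open>The states of \<open>D\<close> are the inputs. Either the map is given by a circuit, so that it is even,
  or there are enough free states to repair its sign.\<close>

definition sign_free :: "nat \<Rightarrow> nat set set \<Rightarrow> (nat set \<Rightarrow> nat set) \<Rightarrow> bool" where
  "sign_free m D g \<longleftrightarrow> 2 \<le> card (Pow {..<m} - D) \<or>
     (\<exists>C. valid_circuit m C \<and> (\<forall>s\<subseteq>{..<m}. run C s = g s))"

definition moved :: "nat set set \<Rightarrow> (nat set \<Rightarrow> nat set) \<Rightarrow> nat set set" where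
  "moved D g = {x \<in> D. g x \<noteq> x}"

text \<open>Peels off one circuit in the inductions below: composing with its inverse settles the
  inputs in \<open>X\<close> and disturbs no settled input. A circuit for \<open>g'\<close> followed
  by \<open>C\<close> then realises \<open>g\<close>.\<close>

lemma undo_step:
  assumes g: "bij_betw g (Pow {..<m}) (Pow {..<m})" "sign_free m D g" and C: "valid_circuit m C"
    and X: "\<forall>x\<in>X. run C x = g x"
    and Y: "\<forall>y\<in>D. g y = y \<longrightarrow> run C y = y"
  defines "g' \<equiv> run (rev C) \<circ> g"
  shows "bij_betw g' (Pow {..<m}) (Pow {..<m})" "sign_free m D g'" "moved D g' \<subseteq> moved D g - X"
    "run C (g' y) = g y"
proof -
  have "bij_betw (run (rev C)) (Pow {..<m}) (Pow {..<m})"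
    using C by (intro bij_betw_run) simp
  then show "bij_betw g' (Pow {..<m}) (Pow {..<m})"
    unfolding g'_def using g(1) bij_betw_trans by blast
  show "sign_free m D g'"
    using g(2) unfolding sign_free_def
  proof (elim disjE exE conjE)
    fix C0 assume "valid_circuit m C0" "\<forall>s\<subseteq>{..<m}. run C0 s = g s"
    then show "2 \<le> card (Pow {..<m} - D) \<or> (\<exists>C. valid_circuit m C \<and> (\<forall>s\<subseteq>{..<m}. run C s = g' s))"
      using C by (intro disjI2 exI[of _ "C0 @ rev C"]) (auto simp: g'_def)
  qed auto
  have "g' x = x" if "x \<in> X" for x
    using X that run_rev[OF C, of x] by (simp add: g'_def)
  moreover have "g' y = y" if "y \<in> D" "g y = y" for y
    using Y that run_rev[OF C, of y] that by (simp add: g'_def)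
  ultimately show "moved D g' \<subseteq> moved D g - X" by (auto simp: moved_def)
  show "run C (g' y) = g y" by (simp add: g'_def run_rev'[OF C])
qed

text \<open>A 3-cycle through \<open>x\<close>, \<open>g x\<close> and a third state
  \<open>b\<close> settles \<open>x\<close>. Choosing \<open>b\<close> away from the inputs already
  fixed by \<open>g\<close> keeps those intact.\<close>

lemma bijection_circuit_three_cycles:
  assumes "bij_betw g (Pow {..<m}) (Pow {..<m})" "sign_free m D g" "D \<subseteq> Pow {..<m}" "64 \<le> m"
  shows "\<exists>C. valid_circuit m C \<and> length C \<le> card (moved D g) * (24 * m + 4120) \<and> (\<forall>x\<in>D. run C x = g x)"
  using assms(1,2)
proof (induction "card (moved D g)" arbitrary: g rule: less_induct)
  case less
  have finD: "finite D" using assms(3) finite_subset by blast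
  have finM: "finite (moved D g)" using finD by (simp add: moved_def)
  have gP: "g s \<subseteq> {..<m}" if "s \<subseteq> {..<m}" for s using less.prems(1) that bij_betwE by blast
  have ginj: "g s = g s' \<longleftrightarrow> s = s'" if "s \<subseteq> {..<m}" "s' \<subseteq> {..<m}" for s s'
    using less.prems(1) that by (auto simp: bij_betw_def inj_on_def)
  show ?case
  proof (cases "moved D g = {}")
    case True
    then show ?thesis by (intro exI[of _ "[]"]) (auto simp: moved_def)
  next
    case False
    then obtain x where x: "x \<in> D" "g x \<noteq> x" by (auto simp: moved_def)
    have xP: "x \<subseteq> {..<m}" using x assms(3) by auto
    \<comment> \<open>Otherwise every state except \<open>x\<close> and \<open>g x\<close> is a
      fixed input. Then \<open>g x\<close> is the only possible free state, and a \<open>g\<close>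
      given by a circuit would be the transposition of \<open>x\<close> and \<open>g x\<close>,
      contradicting parity.\<close>
    have "\<exists>b. b \<subseteq> {..<m} \<and> b \<noteq> x \<and> b \<noteq> g x \<and> (b \<notin> D \<or> g b \<noteq> b)"
    proof (rule ccontr)
      assume "\<not> ?thesis"
      then have rest: "b \<in> D \<and> g b = b" if "b \<subseteq> {..<m}" "b \<noteq> x" "b \<noteq> g x" for b using that by blast
      show False
        using less.prems(2) unfolding sign_free_def
      proof (elim disjE exE conjE)
        assume "2 \<le> card (Pow {..<m} - D)"
        moreover have "Pow {..<m} - D \<subseteq> {g x}" using rest x by auto
        then have "card (Pow {..<m} - D) \<le> card {g x}" by (intro card_mono) auto
        ultimately show False by simp
      next
        fix C assume C: "valid_circuit m C" "\<forall>s\<subseteq>{..<m}. run C s = g s"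
        have "g (g x) = x"
        proof (rule ccontr)
          assume "g (g x) \<noteq> x"
          moreover have "g (g x) \<noteq> g x" using ginj[OF gP[OF xP] xP] x by simp
          ultimately have "g (g (g x)) = g (g x)" 
            using rest[OF gP[OF gP[OF xP]]] by simp
          then show False
            using \<open>g (g x) \<noteq> g x\<close> ginj[OF gP[OF gP[OF xP]] gP[OF xP]] by simp
        qed
        then have "g s = transpose x (g x) s" if "s \<subseteq> {..<m}" for s
          using rest[OF that] by (auto simp: transpose_def)
        moreover obtain s where "s \<subseteq> {..<m}" "run C s \<noteq> transpose x (g x) s"
          using run_ne_transposition[OF C(1), of x "g x"] x xP gP assms(4) by auto
        ultimately show False using C(2) by auto
      qed
    qed
    then obtain b where b: "b \<subseteq> {..<m}" "b \<noteq> x" "b \<noteq> g x" "b \<notin> D \<or> g b \<noteq> b" by blast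
    obtain C where C: "valid_circuit m C" "length C \<le> 24 * m + 4120"
        "run C x = g x" "run C (g x) = b" "run C b = x"
        "\<And>s. s \<subseteq> {..<m} \<Longrightarrow> s \<notin> {x, g x, b} \<Longrightarrow> run C s = s"
      by (rule three_cycle_circuit[OF assms(4), of x "g x" b]) (use x xP b gP[OF xP] in auto)
    have fixed: "run C y = y" if "y \<in> D" "g y = y" for y
      using that x b assms(3) ginj[of y x] xP by (intro C(6)) auto
    have X: "\<forall>y\<in>{x}. run C y = g y" and Y: "\<forall>y\<in>D. g y = y \<longrightarrow> run C y = y"
      using C(3) fixed by simp_all
    define g' where "g' = run (rev C) \<circ> g"
    have g': "bij_betw g' (Pow {..<m}) (Pow {..<m})" "sign_free m D g'"
        "moved D g' \<subseteq> moved D g - {x}" "\<And>y. run C (g' y) = g y"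
      unfolding g'_def by (rule undo_step[OF less.prems C(1) X Y])+
    have "card (moved D g') \<le> card (moved D g - {x})" using finM g'(3) by (intro card_mono) auto
    moreover have "Suc (card (moved D g - {x})) = card (moved D g)"
      using finM x by (intro card_Suc_Diff1) (auto simp: moved_def)
    ultimately have lt: "card (moved D g') + 1 \<le> card (moved D g)" by linarith
    then obtain C' where C': "valid_circuit m C'" "length C' \<le> card (moved D g') * (24 * m + 4120)"
        "\<And>x. x \<in> D \<Longrightarrow> run C' x = g' x"
      using less.hyps[OF _ g'(1,2)] by auto
    have "length (C' @ C) \<le> (card (moved D g') + 1) * (24 * m + 4120)" using C C' by simp
    also have "\<dots> \<le> card (moved D g) * (24 * m + 4120)" using lt by (intro mult_le_mono) auto
    finally show ?thesis
      using C(1) C'(1,3) g'(4) by (intro exI[of _ "C' @ C"]) auto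
  qed
qed

text \<open>The length is multiplied by \<open>K\<close> to avoid division: every batch settles
  \<open>K\<close> inputs, so each moved input pays for one \<open>K\<close>-th of a batch. Below
  \<open>3 * K\<close> moved inputs no batch is guaranteed and 3-cycles take over.\<close>

lemma bijection_circuit:
  assumes "bij_betw g (Pow {..<m}) (Pow {..<m})" "sign_free m D g" "D \<subseteq> Pow {..<m}"
    and k: "0 < k" "4 * 4 ^ 2 ^ k \<le> m"
  defines "K \<equiv> 2 ^ k"
  shows "\<exists>C. valid_circuit m C \<and> (\<forall>x\<in>D. run C x = g x) \<and>
    K * length C \<le> card (moved D g) * (12 * m + 12 + 64 * K * 4 ^ K) + K * (3 * K * (24 * m + 4120))"
  using assms(1,2)
proof (induction "card (moved D g)" arbitrary: g rule: less_induct)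
  case less
  have finD: "finite D" using assms(3) finite_subset by blast
  have finM: "finite (moved D g)" using finD by (simp add: moved_def)
  have MP: "moved D g \<subseteq> Pow {..<m}" using assms(3) by (auto simp: moved_def)
  have gP: "g s \<subseteq> {..<m}" if "s \<subseteq> {..<m}" for s using less.prems(1) that bij_betwE by blast
  have ginj: "inj_on g (Pow {..<m})" using less.prems(1) by (simp add: bij_betw_def)
  have "(2::nat) ^ 1 \<le> 2 ^ k" using k(1) by (intro power_increasing) auto
  then have "(4::nat) ^ 2 \<le> 4 ^ 2 ^ k" by (intro power_increasing) auto
  then have m: "64 \<le> m" using k(2) by simp
  show ?case
  proof (cases "card (moved D g) < 3 * K")
    case True
    obtain C where C: "valid_circuit m C" "length C \<le> card (moved D g) * (24 * m + 4120)" "\<forall>x\<in>D. run C x = g x"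
      using bijection_circuit_three_cycles[OF less.prems assms(3) m] by blast
    note C(2)
    also have "card (moved D g) * (24 * m + 4120) \<le> 3 * K * (24 * m + 4120)"
      using True by (intro mult_le_mono) auto
    finally have "K * length C \<le> K * (3 * K * (24 * m + 4120))" by (rule mult_le_mono2)
    then show ?thesis using C(1,3) by (intro exI[of _ C] conjI trans_le_add2)
  next
    case False
    then obtain S where S: "S \<subseteq> moved D g" "card S = K" "S \<inter> g ` S = {}"
      using disjoint_batch[OF finM inj_on_subset[OF ginj MP], of K] by (auto simp: moved_def)
    obtain C where C: "valid_circuit m C" "length C \<le> 12 * m + 12 + 64 * 2 ^ k * 4 ^ 2 ^ k"
        "\<And>x. x \<in> S \<Longrightarrow> run C x = g x" "\<And>x. x \<in> S \<Longrightarrow> run C (g x) = x"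
        "\<And>s. s \<subseteq> {..<m} \<Longrightarrow> s \<notin> S \<Longrightarrow> s \<notin> g ` S \<Longrightarrow> run C s = s"
    proof (rule transpositions_circuit[of S k m g])
      show "card S = 2 ^ k" using S by (simp add: K_def)
      show "S \<subseteq> Pow {..<m}" using S MP by auto
      then show "inj_on g S" by (rule inj_on_subset[OF ginj])
      show "g ` S \<subseteq> Pow {..<m}" using gP \<open>S \<subseteq> Pow {..<m}\<close> by blast
    qed (use S k in auto)
    have fixed: "run C y = y" if "y \<in> D" "g y = y" for y
    proof (rule C(5))
      show yP: "y \<subseteq> {..<m}" using that assms(3) by auto
      show "y \<notin> S" using that S by (auto simp: moved_def)
      show "y \<notin> g ` S"
      proof
        assume "y \<in> g ` S"
        then obtain x where x: "x \<in> S" "g x = y" by auto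
        have "x \<in> Pow {..<m}" using x(1) S(1) MP by blast
        then have "y = x"
          using x(2) that(2) yP by (metis PowI inj_onD ginj)
        then show False using \<open>y \<notin> S\<close> x(1) by simp
      qed
    qed
    have X: "\<forall>x\<in>S. run C x = g x" and Y: "\<forall>y\<in>D. g y = y \<longrightarrow> run C y = y"
      using C(3) fixed by simp_all
    define g' where "g' = run (rev C) \<circ> g"
    have g': "bij_betw g' (Pow {..<m}) (Pow {..<m})" "sign_free m D g'"
        "moved D g' \<subseteq> moved D g - S" "\<And>y. run C (g' y) = g y"
      unfolding g'_def by (rule undo_step[OF less.prems C(1) X Y])+
    have "card (moved D g') \<le> card (moved D g - S)" using finM g'(3) by (intro card_mono) auto
    also have "\<dots> = card (moved D g) - K" using S finM by (simp add: card_Diff_subset finite_subset)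
    finally have le: "card (moved D g') + K \<le> card (moved D g)" using False by simp
    have "0 < K" by (simp add: K_def)
    then obtain C' where C': "valid_circuit m C'" "\<And>x. x \<in> D \<Longrightarrow> run C' x = g' x"
        "K * length C' \<le> card (moved D g') * (12 * m + 12 + 64 * K * 4 ^ K) + K * (3 * K * (24 * m + 4120))"
      using less.hyps[OF _ g'(1,2)] le by auto
    define G where "G = 12 * m + 12 + 64 * K * 4 ^ K"
    have "K * length C \<le> K * G" using C(2) by (intro mult_le_mono2) (simp add: G_def K_def)
    then have "K * length (C' @ C) \<le> (card (moved D g') + K) * G + K * (3 * K * (24 * m + 4120))"
      using C'(3)[folded G_def] unfolding length_append add_mult_distrib add_mult_distrib2 by linarith
    also have "\<dots> \<le> card (moved D g) * G + K * (3 * K * (24 * m + 4120))"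
      using le by (intro add_mono mult_le_mono) auto
    finally show ?thesis
      using C(1) C'(1,2) g'(4) by (intro exI[of _ "C' @ C"]) (auto simp: G_def)
  qed
qed

section \<open>Transfer to lists\<close>

definition ones :: "bool list \<Rightarrow> nat set" where
  "ones xs = {i. i < length xs \<and> xs ! i}"

lemma ones_subset: "ones xs \<subseteq> {..<length xs}"
  by (auto simp: ones_def)

lemma ones_inject:
  assumes "length xs = length ys"
  shows "ones xs = ones ys \<longleftrightarrow> xs = ys"
proof
  assume "ones xs = ones ys"
  then have iff: "i \<in> ones xs \<longleftrightarrow> i \<in> ones ys" for i by simp
  have "xs ! i = ys ! i" if "i < length xs" for i
    using iff[of i] that assms by (simp add: ones_def)
  then show "xs = ys" using assms by (simp add: list_eq_iff_nth_eq)
qed simp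

lemma ones_phi: "ones (phi q xs) = ones xs"
proof -
  have "i < length xs + q \<and> (xs @ replicate q False) ! i \<longleftrightarrow> i < length xs \<and> xs ! i" for i
    by (cases "i < length xs") (auto simp: nth_append)
  then show ?thesis by (simp add: ones_def phi_def)
qed

lemma ones_psi: "ones (psi n xs) = ones xs \<inter> {..<n}"
  by (auto simp: ones_def psi_def)

lemma ones_apply_gate:
  assumes "valid_gate (length xs) g"
  shows "ones (apply_gate g xs) = gate_act g (ones xs)" "length (apply_gate g xs) = length xs"
proof -
  obtain cs j where g: "g = Gate cs j" by (cases g)
  have "(\<forall>i\<in>set cs. xs ! i) \<longleftrightarrow> set cs \<subseteq> ones xs"
    using assms by (auto simp: g ones_def)
  then show "ones (apply_gate g xs) = gate_act g (ones xs)"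
    using assms by (auto simp: g ones_def nth_list_update)
  show "length (apply_gate g xs) = length xs" by (simp add: g)
qed

lemma ones_run_circuit:
  assumes "valid_circuit (length xs) C"
  shows "ones (run_circuit C xs) = run C (ones xs) \<and> length (run_circuit C xs) = length xs"
  using assms
proof (induction C arbitrary: xs)
  case (Cons g C)
  then show ?case
    using ones_apply_gate[of xs g] Cons.IH[of "apply_gate g xs"] by (simp add: run_circuit_def)
qed (simp add: run_circuit_def)

text \<open>Additional zero inputs vanish in the set view. The length is demanded separately because
  \<open>ones\<close> forgets trailing zeros.\<close>

lemma implements_iff_ones:
  "implements n q C f \<longleftrightarrow> valid_circuit (n + q) C \<and>
    (\<forall>xs. length xs = n \<longrightarrow> length (f xs) = n \<and> ones (f xs) = run C (ones xs) \<inter> {..<n})"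
proof (cases "valid_circuit (n + q) C")
  case True
  have "psi n (run_circuit C (phi q xs)) = f xs \<longleftrightarrow>
      length (f xs) = n \<and> ones (f xs) = run C (ones xs) \<inter> {..<n}" if "length xs = n" for xs
  proof -
    have len: "length (phi q xs) = n + q" using that by (simp add: phi_def)
    then have r: "ones (run_circuit C (phi q xs)) = run C (ones xs)" "length (run_circuit C (phi q xs)) = n + q"
      using ones_run_circuit[of "phi q xs" C] True by (simp_all add: ones_phi)
    then have l: "length (psi n (run_circuit C (phi q xs))) = n" by (simp add: psi_def)
    show ?thesis
      using ones_inject[of "psi n (run_circuit C (phi q xs))" "f xs"] l r(1) ones_psi by metis
  qed
  then show ?thesis using True by (auto simp: implements_def)
qed (simp add: implements_def)

text \<open>With more than \<open>n\<close> additional lines, \<open>n\<close> of them suffice: the map sending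
  \<open>(a, b)\<close> to \<open>(b + f a, a)\<close> is a bijection that extends \<open>f\<close>.\<close>

lemma bijection_extending:
  assumes f: "f \<in> F n q" and n: "2 \<le> n"
  obtains g where "bij_betw g (Pow {..<n + min q n}) (Pow {..<n + min q n})"
    "sign_free (n + min q n) (Pow {..<n}) g"
    "\<And>xs. length xs = n \<Longrightarrow> length (f xs) = n \<and> ones (f xs) = g (ones xs) \<inter> {..<n}"
proof -
  obtain C where C: "valid_circuit (n + q) C"
      "\<And>xs. length xs = n \<Longrightarrow> length (f xs) = n \<and> ones (f xs) = run C (ones xs) \<inter> {..<n}"
    using f unfolding F_def implements_iff_ones by auto
  show thesis
  proof (cases "q \<le> n")
    case True
    \<comment> \<open>With few additional lines the circuit itself supplies the bijection, and
      \<open>sign_free\<close> holds by its second alternative.\<close>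
    then have "n + min q n = n + q" by simp
    then show thesis
      using that[of "run C"] bij_betw_run[OF C(1)] C by (auto simp: sign_free_def)
  next
    case False
    define fs where "fs s = run C s \<inter> {..<n}" for s
    \<comment> \<open>The upper lines hold \<open>b\<close> on input and \<open>a\<close> on output,
      so the output remembers \<open>a\<close> and adding \<open>f a\<close> can be undone.\<close>
    define g where "g s = {i. i < n \<and> ((i + n \<in> s) \<noteq> (i \<in> fs (s \<inter> {..<n})))} \<union> {i. n \<le> i \<and> i < n + n \<and> i - n \<in> s}" for s
    have lo: "i \<in> g s \<longleftrightarrow> ((i + n \<in> s) \<noteq> (i \<in> fs (s \<inter> {..<n})))" if "i < n" for i s
      using that by (auto simp: g_def)
    have hi: "i + n \<in> g s \<longleftrightarrow> i \<in> s" if "i < n" for i s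
      using that by (auto simp: g_def)
    have "s = s'" if s: "s \<subseteq> {..<n + n}" "s' \<subseteq> {..<n + n}" "g s = g s'" for s s'
    proof -
      have 1: "i \<in> s \<longleftrightarrow> i \<in> s'" if "i < n" for i using hi[OF that] s(3) by metis
      then have "s \<inter> {..<n} = s' \<inter> {..<n}" by auto
      then have 2: "i + n \<in> s \<longleftrightarrow> i + n \<in> s'" if "i < n" for i using lo[OF that] s(3) by metis
      have "i \<in> s \<longleftrightarrow> i \<in> s'" for i
      proof -
        consider "i < n" | "n \<le> i" "i < n + n" | "n + n \<le> i" by linarith
        then show ?thesis
        proof cases
          case 2
          then show ?thesis using \<open>\<And>i. i < n \<Longrightarrow> (i + n \<in> s) = (i + n \<in> s')\<close>[of "i - n"] by simp
        qed (use 1 s in auto)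
      qed
      then show "s = s'" by auto
    qed
    then have "inj_on g (Pow {..<n + n})" by (auto intro!: inj_onI)
    moreover have "g ` Pow {..<n + n} \<subseteq> Pow {..<n + n}" by (auto simp: g_def)
    ultimately have bij: "bij_betw g (Pow {..<n + n}) (Pow {..<n + n})"
      by (simp add: bij_betw_def endo_inj_surj)
    \<comment> \<open>By \<open>2 \<le> n\<close> both \<open>n\<close> and \<open>Suc n\<close> are
      among the lines, and neither singleton is an input: two free states.\<close>
    have "card {{n}, {Suc n}} \<le> card (Pow {..<n + n} - Pow {..<n})"
      using n by (intro card_mono) auto
    then have "sign_free (n + n) (Pow {..<n}) g" by (simp add: sign_free_def)
    moreover have "g (ones xs) \<inter> {..<n} = run C (ones xs) \<inter> {..<n}" if "length xs = n" for xs
      using that ones_subset[of xs] by (auto simp: g_def fs_def Int_absorb2)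
    moreover have "n + min q n = n + n" using False by simp
    ultimately show thesis using that[of g] bij C(2) by simp
  qed
qed

text \<open>At most \<open>2 ^ n\<close> inputs are moved, and \<open>m \<le> 2 * n\<close> turns
  \<open>12 * m\<close> into \<open>24 * n\<close>.\<close>

lemma complexity_bound:
  assumes f: "f \<in> F n q" and k: "0 < k" "4 * 4 ^ 2 ^ k \<le> n"
  defines "K \<equiv> 2 ^ k"
  shows "K * complexity n q f \<le> 2 ^ n * (24 * n + 12 + 64 * K * 4 ^ K) + K * (3 * K * (48 * n + 4120))"
proof -
  have "(1::nat) \<le> 4 ^ 2 ^ k" by simp
  then have n: "2 \<le> n" using k(2) by linarith
  define m where "m = n + min q n"
  have m: "n \<le> m" "m \<le> 2 * n" "m \<le> n + q" by (simp_all add: m_def)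
  obtain g where g: "bij_betw g (Pow {..<m}) (Pow {..<m})" "sign_free m (Pow {..<n}) g"
      "\<And>xs. length xs = n \<Longrightarrow> length (f xs) = n \<and> ones (f xs) = g (ones xs) \<inter> {..<n}"
    using bijection_extending[OF f n] unfolding m_def by metis
  have "Pow {..<n} \<subseteq> Pow {..<m}" using m(1) by auto
  moreover have "4 * 4 ^ 2 ^ k \<le> m" using k m(1) by linarith
  ultimately obtain C where C: "valid_circuit m C" "\<And>x. x \<subseteq> {..<n} \<Longrightarrow> run C x = g x"
    "K * length C \<le> card (moved (Pow {..<n}) g) * (12 * m + 12 + 64 * K * 4 ^ K) + K * (3 * K * (24 * m + 4120))"
    using bijection_circuit[OF g(1,2) _ k(1)] unfolding K_def by auto
  have "implements n q C f"
    unfolding implements_iff_ones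
  proof (intro conjI allI impI)
    show "valid_circuit (n + q) C" by (rule valid_circuit_mono[OF C(1) m(3)])
    fix xs :: "bool list"
    assume len: "length xs = n"
    then have "run C (ones xs) = g (ones xs)" using C(2) ones_subset by blast
    then show "length (f xs) = n" "ones (f xs) = run C (ones xs) \<inter> {..<n}" using g(3)[OF len] by simp_all
  qed
  then have "complexity n q f \<le> length C"
    unfolding complexity_def by (intro Least_le) auto
  then have "K * complexity n q f \<le> K * length C" by simp
  also note C(3)
  also have "card (moved (Pow {..<n}) g) * (12 * m + 12 + 64 * K * 4 ^ K) + K * (3 * K * (24 * m + 4120))
      \<le> 2 ^ n * (24 * n + 12 + 64 * K * 4 ^ K) + K * (3 * K * (48 * n + 4120))"
  proof (rule add_mono; rule mult_le_mono)
    have "card (moved (Pow {..<n}) g) \<le> card (Pow {..<n})"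
      by (intro card_mono) (auto simp: moved_def)
    then show "card (moved (Pow {..<n}) g) \<le> 2 ^ n" by (simp add: card_Pow)
    show "12 * m + 12 + 64 * K * 4 ^ K \<le> 24 * n + 12 + 64 * K * 4 ^ K" using m(2) by simp
    show "3 * K * (24 * m + 4120) \<le> 3 * K * (48 * n + 4120)" using m(2) by (intro mult_le_mono2) simp
  qed simp
  finally show ?thesis .
qed

lemma L_bound:
  assumes k: "0 < k" "4 * 4 ^ 2 ^ k \<le> n"
  defines "K \<equiv> 2 ^ k"
  shows "K * L n q \<le> 2 ^ n * (24 * n + 12 + 64 * K * 4 ^ K) + K * (3 * K * (48 * n + 4120))"
    (is "_ \<le> ?B")
proof -
  let ?S = "{complexity n q f | f. f \<in> F n q}"
  have le: "K * c \<le> ?B" if "c \<in> ?S" for c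
    using that complexity_bound[OF _ k] unfolding K_def by blast
  \<comment> \<open>\<open>F n q\<close> is infinite, since values on lists of other lengths are
    unconstrained; that the complexities form a finite set is drawn from the bound itself.\<close>
  have "c \<le> K * c" for c by (simp add: K_def)
  then have "?S \<subseteq> {..?B}" using le by (blast intro: order_trans)
  then have "finite ?S" using finite_subset by blast
  moreover have "implements n q [] (\<lambda>xs. psi n (run_circuit [] (phi q xs)))"
    by (simp add: implements_def)
  then have "?S \<noteq> {}" by (auto simp: F_def)
  ultimately have "L n q \<in> ?S" unfolding L_def by (rule Max_in)
  then show ?thesis by (rule le)
qed

section \<open>Asymptotics\<close>

text \<open>\<open>2 ^ k\<close> is the largest power of two up to a third of the logarithm; the
  restriction to powers of two loses less than a factor 2. The threshold 24 forces
  \<open>3 \<le> k\<close>.\<close>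

lemma batch_size_exists:
  assumes "24 \<le> log 2 (real n)"
  obtains k :: nat where "3 \<le> k" "3 * 2 ^ k \<le> log 2 (real n)" "log 2 (real n) < 6 * 2 ^ k"
proof -
  define x where "x = log 2 (real n) / 3"
  have x: "8 \<le> x" using assms by (simp add: x_def)
  define k where "k = nat \<lfloor>log 2 x\<rfloor>"
  have "3 = log 2 (2 powr 3)" by (simp only: log_powr_cancel)
  also have "\<dots> \<le> log 2 x" using x by (intro log_mono) auto
  finally have l: "3 \<le> log 2 x" .
  have k: "real k \<le> log 2 x" "log 2 x < real k + 1" using l by (auto simp: k_def)
  have "2 ^ k \<le> x" using k(1) x by (simp add: le_log_iff powr_realpow)
  moreover have "x < 2 ^ (k + 1)"
    using k(2) x by (simp add: log_less_iff powr_realpow powr_add)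
  moreover have "3 \<le> k" using l by (simp add: k_def le_nat_iff le_floor_iff)
  ultimately show thesis using that[of k] by (simp add: x_def)
qed

lemma L_real_bound:
  assumes "24 \<le> log 2 (real n)"
  shows "real (L n q) \<le> 180 * real n * 2 ^ n / log 2 (real n) + log 2 (real n) * (48 * real n + 4120)"
proof -
  obtain k :: nat where k: "3 \<le> k" "3 * 2 ^ k \<le> log 2 (real n)" "log 2 (real n) < 6 * 2 ^ k"
    using batch_size_exists[OF assms] .
  define K :: nat where "K = 2 ^ k"
  have "(2::nat) ^ 3 \<le> 2 ^ k" using k(1) by (intro power_increasing) auto
  then have K8: "8 \<le> K" by (simp add: K_def)
  have K: "3 * real K \<le> log 2 (real n)" "log 2 (real n) < 6 * real K" using k by (simp_all add: K_def)
  have n0: "0 < n" using assms by (cases n) (auto simp: log_def)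
  have "real (8 ^ K) = 2 powr (3 * real K)"
    by (simp add: powr_powr[symmetric] powr_realpow)
  also have "\<dots> \<le> real n" using K(1) n0 by (simp add: le_log_iff)
  finally have n8: "8 ^ K \<le> n" by simp
  \<comment> \<open>Equality holds at \<open>j = 8\<close>, the least value allowed for
    \<open>K\<close>. With \<open>8 ^ K = 2 ^ K * 4 ^ K \<le> n\<close> this bounds
    \<open>64 * K * 4 ^ K\<close> by \<open>2 * n\<close>.\<close>
  have two: "64 * j \<le> 2 * 2 ^ j" if "8 \<le> j" for j :: nat
    using that by (induction j rule: dec_induct) auto
  have pow: "(8::nat) ^ K = 2 ^ K * 4 ^ K" by (simp add: power_mult_distrib[symmetric])
  have "64 * K * 4 ^ K \<le> 2 * 2 ^ K * 4 ^ K" using two[OF K8] by (intro mult_le_mono1)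
  then have s1: "64 * K * 4 ^ K \<le> 2 * n" using n8 pow by linarith
  have "(8::nat) ^ 2 \<le> 8 ^ K" using K8 by (intro power_increasing) auto
  then have s2: "12 \<le> n" using n8 by simp
  have "(4::nat) \<le> 2 ^ K" using two[OF K8] K8 by linarith
  then have "4 * 4 ^ K \<le> 2 ^ K * (4::nat) ^ K" by (rule mult_le_mono1)
  then have s3: "4 * 4 ^ 2 ^ k \<le> n" using n8 pow unfolding K_def by linarith
  have "K * L n q \<le> 2 ^ n * (24 * n + 12 + 64 * K * 4 ^ K) + K * (3 * K * (48 * n + 4120))"
    unfolding K_def using L_bound[OF _ s3] k(1) by simp
  \<comment> \<open>The bracket is at most \<open>24 * n + n + 2 * n\<close>, rounded up to
    \<open>30 * n\<close>; the bound of the logarithm by \<open>6 * K\<close> then yields the factor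
    180.\<close>
  also have "\<dots> \<le> 2 ^ n * (30 * n) + K * (3 * K * (48 * n + 4120))"
    using s1 s2 by (intro add_mono mult_le_mono2) auto
  finally have "real (K * L n q) \<le> real (2 ^ n * (30 * n) + K * (3 * K * (48 * n + 4120)))"
    by (rule of_nat_mono)
  then have "real (L n q) \<le> 2 ^ n * (30 * real n) / real K + 3 * real K * (48 * real n + 4120)"
    using K8 by (simp add: field_simps)
  also have "2 ^ n * (30 * real n) / real K \<le> 2 ^ n * (30 * real n) / (log 2 (real n) / 6)"
    using K(2) assms K8 by (intro divide_left_mono mult_pos_pos) auto
  also have "3 * real K * (48 * real n + 4120) \<le> log 2 (real n) * (48 * real n + 4120)"
    using K(1) by (intro mult_right_mono) auto
  finally show ?thesis by (simp add: mult_ac)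
qed

theorem theorem1:
  fixes q :: "nat \<Rightarrow> nat"
  shows "\<forall>\<epsilon>>0. eventually
     (\<lambda>n. real (L n (q n)) \<le> (1 + \<epsilon>) * (192 * real n * 2 ^ n / log 2 (real n))) at_top"
proof (intro allI impI)
  fix \<epsilon> :: real
  assume "0 < \<epsilon>"
  have "eventually (\<lambda>n::nat. 24 \<le> log 2 (real n)) at_top" by real_asymp
  \<comment> \<open>The slack \<open>192 - 180 = 12\<close> absorbs the cost of the final 3-cycles,
    which grows only like \<open>n * log 2 n\<close>.\<close>
  moreover have "eventually (\<lambda>n::nat. log 2 (real n) * (48 * real n + 4120) \<le> 12 * real n * 2 ^ n / log 2 (real n)) at_top"
    by real_asymp
  ultimately show "eventually
     (\<lambda>n. real (L n (q n)) \<le> (1 + \<epsilon>) * (192 * real n * 2 ^ n / log 2 (real n))) at_top"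
  proof eventually_elim
    case (elim n)
    have "real (L n (q n)) \<le> 180 * real n * 2 ^ n / log 2 (real n) + 12 * real n * 2 ^ n / log 2 (real n)"
      using L_real_bound[OF elim(1), of "q n"] elim(2) by linarith
    also have "\<dots> = 192 * real n * 2 ^ n / log 2 (real n)" by (simp add: add_divide_distrib[symmetric])
    also have "\<dots> \<le> (1 + \<epsilon>) * (192 * real n * 2 ^ n / log 2 (real n))"
      using \<open>0 < \<epsilon>\<close> elim(1) by (intro mult_right_mono[of 1 "1 + \<epsilon>", simplified]) auto
    finally show ?case .
  qed
qed

end
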